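(* Let $n,k$ be positive integers with $n\ge 2k+1$. If $3\binom{n-k}{k} \ge 2\binom{n}{k}$ and $k \ge 2$, then $tw(BK(n,k)) = \binom{n}{k} - 1$.
   Context: The bipartite Kneser graph $BK(n,k)$ is the bipartite graph whose two parts are the family of all $k$-subsets of $[n]=\{1,\dots,n\}$ and the family of all $(n-k)$-subsets of $[n]$, a $k$-subset $A$ and an $(n-k)$-subset $B$ being adjacent iff $A\subseteq B$. $tw(G)$ denotes treewidth. *)

theory Defs
  imports Complex_Main "Graph_Theory.Graph_Theory"
begin

text \<open>
  A finite simple graph is a \<^locale>\<open>pair_graph\<close>: finitely many vertices and a symmetric,
  irreflexive set of arcs, each edge being represented by its two arcs.
\<close>

text \<open>
  The parts are disjoint, and the graph is loop-free, for \<^term>\<open>n \<noteq> 2 * k\<close>; no tagging of the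
  two parts is needed in this range.
\<close>

definition bipartite_kneser :: "nat \<Rightarrow> nat \<Rightarrow> nat set pair_pre_digraph" where
  "bipartite_kneser n k =
     (let P = {A. A \<subseteq> {1..n} \<and> card A = k};
          Q = {B. B \<subseteq> {1..n} \<and> card B = n - k};
          E = {(A, B). A \<in> P \<and> B \<in> Q \<and> A \<subseteq> B}
      in \<lparr> pverts = P \<union> Q, parcs = E \<union> E\<inverse> \<rparr>)"

lemma pair_graph_bipartite_kneser:
  assumes "2 * k < n"
  shows "pair_graph (bipartite_kneser n k)"
proof -
  have "pverts (bipartite_kneser n k) \<subseteq> Pow {1..n}"
    by (auto simp: bipartite_kneser_def Let_def)
  then have fin: "finite (pverts (bipartite_kneser n k))"
    by (rule finite_subset) simp
  have sub: "parcs (bipartite_kneser n k)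
      \<subseteq> pverts (bipartite_kneser n k) \<times> pverts (bipartite_kneser n k)"
    by (auto simp: bipartite_kneser_def Let_def)
  have finp: "finite (parcs (bipartite_kneser n k))"
    by (rule finite_subset[OF sub]) (simp add: fin)
  have sym: "sym (parcs (bipartite_kneser n k))"
    unfolding bipartite_kneser_def Let_def by (simp add: sym_Un_converse)
  have loop: "fst e \<noteq> snd e" if "e \<in> parcs (bipartite_kneser n k)" for e
  proof -
    have "(card (fst e) = k \<and> card (snd e) = n - k) \<or> (card (fst e) = n - k \<and> card (snd e) = k)"
      using that unfolding bipartite_kneser_def Let_def by force
    moreover have "n - k \<noteq> k"
      using assms by linarith
    ultimately show ?thesis by metis
  qed
  show ?thesis
  proof (unfold_locales, goal_cases)
    case (1 e) then show ?case using sub by fastforce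
  next
    case (2 e) then show ?case using sub by fastforce
  next
    case 3 then show ?case by (rule fin)
  next
    case 4 then show ?case by (rule finp)
  next
    case (5 e) then show ?case by (rule loop)
  next
    case 6 then show ?case using sym by (simp add: symmetric_def)
  qed
qed

text \<open>
  The library's \<^const>\<open>tree\<close> does not fit this encoding of undirected graphs: the closed walk
  \<open>u, v, u\<close> along the two arcs of one edge counts as a \<^const>\<open>pre_digraph.cycle\<close>. The cycles of
  an undirected simple graph are those of length at least three. Trees are finite and, since
  \<^const>\<open>connected\<close> excludes the null graph, nonempty.
\<close>

definition undirected_tree :: "'a pair_pre_digraph \<Rightarrow> bool" where
  "undirected_tree T \<longleftrightarrow>
     pair_graph T \<and> connected (with_proj T) \<and>
     \<not> (\<exists>p. pre_digraph.cycle (with_proj T) p \<and> 3 \<le> length p)"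

definition tree_decomposition ::
    "'a pair_pre_digraph \<Rightarrow> 't pair_pre_digraph \<Rightarrow> ('t \<Rightarrow> 'a set) \<Rightarrow> bool" where
  "tree_decomposition G T bag \<longleftrightarrow>
     undirected_tree T \<and>
     (\<Union>t \<in> pverts T. bag t) = pverts G \<and>
     (\<forall>(u, v) \<in> parcs G. \<exists>t \<in> pverts T. u \<in> bag t \<and> v \<in> bag t) \<and>
     (\<forall>v \<in> pverts G. connected (with_proj T \<restriction> {t \<in> pverts T. v \<in> bag t}))"

text \<open>
  Natural-number subtraction is exact unless all bags are empty, that is, unless the decomposed
  graph is the null graph.
\<close>

definition decomposition_width :: "'t pair_pre_digraph \<Rightarrow> ('t \<Rightarrow> 'a set) \<Rightarrow> nat" where
  "decomposition_width T bag = Max ((\<lambda>t. card (bag t)) ` pverts T) - 1"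

text \<open>
  Decomposition trees are finite, so taking their nodes in \<^typ>\<open>nat\<close> is no restriction.
\<close>

definition treewidth :: "'a pair_pre_digraph \<Rightarrow> nat" where
  "treewidth G =
     (LEAST w. \<exists>(T :: nat pair_pre_digraph) bag.
        tree_decomposition G T bag \<and> decomposition_width T bag = w)"

end

theory Submission
  imports Defs
begin

text \<open>
  Write \<open>N = n choose k\<close>. The star whose centre carries the part of all \<open>k\<close>-sets and whose leaves
  carry the closed neighbourhoods of the other vertices has width \<open>N - 1\<close>.

  Conversely, suppose that all bags of a tree decomposition have fewer than \<open>N\<close> elements. As the
  graph has \<open>2 N\<close> vertices, some set of fewer than \<open>N\<close> vertices separates two sets \<open>A\<close> and \<open>B\<close>, which
  cover the rest, both larger than \<open>N / 3\<close>. After replacing the \<open>(n - k)\<close>-sets by their complements,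
  the \<open>k\<close>-sets in \<open>A\<close> cross-intersect the \<open>(n - k)\<close>-sets in \<open>B\<close>, and vice versa. The hypothesis on
  \<open>(n - k) choose k\<close> bounds either member of a pair of nonempty cross-intersecting families by
  \<open>N / 3\<close> and the smaller one by \<open>N / 6\<close>. If both pairs are nonempty, then \<open>|A| + |B| \<le> N\<close>; otherwise
  \<open>A\<close> or \<open>B\<close> lies within one part and has at most \<open>N / 3\<close> elements. Both are impossible.
\<close>

subsection \<open>Connectedness and tree edges\<close>

text \<open>Symmetric arcs make the \<open>mk_symmetric\<close> in \<open>connected\<close>
  harmless, so connectedness becomes a statement about the closure of a plain relation, the form in
  which paths are handled below.\<close>

lemma connected_induce_iff:
  assumes "sym (parcs T)"
  shows "connected (with_proj T \<restriction> S) \<longleftrightarrow>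
    S \<noteq> {} \<and> (\<forall>x\<in>S. \<forall>y\<in>S. (x, y) \<in> (parcs T \<inter> S \<times> S)\<^sup>*)"
proof -
  have "parcs (mk_symmetric (with_proj T \<restriction> S)) = parcs T \<inter> S \<times> S"
    using assms by (auto simp: parcs_mk_symmetric induce_subgraph_def sym_def)
  moreover have "(x, y) \<in> rtrancl_on S (parcs T \<inter> S \<times> S) \<longleftrightarrow> (x, y) \<in> (parcs T \<inter> S \<times> S)\<^sup>*"
    if "x \<in> S" "y \<in> S" for x y
    using that by (auto intro: rtrancl_on_rtranclI rtrancl_consistent_rtrancl_on)
  ultimately show ?thesis
    by (auto simp: connected_def strongly_connected_def reachable_def)
qed

lemma connected_iff:
  assumes "pair_graph T"
  shows "connected (with_proj T) \<longleftrightarrow>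
    pverts T \<noteq> {} \<and> (\<forall>x\<in>pverts T. \<forall>y\<in>pverts T. (x, y) \<in> (parcs T)\<^sup>*)"
proof -
  interpret pair_graph T by (rule assms)
  have "sym (parcs T)"
    using sym_arcs by (simp add: symmetric_def)
  moreover have "with_proj T \<restriction> pverts T = with_proj T"
    using in_arcsD1 in_arcsD2 by (auto simp: induce_subgraph_def with_proj_def)
  moreover have "parcs T \<inter> pverts T \<times> pverts T = parcs T"
    using in_arcsD1 in_arcsD2 by auto
  ultimately show ?thesis
    using connected_induce_iff[of T "pverts T"] by simp
qed

lemma pcas_append: "pcas u p v \<Longrightarrow> pcas v q w \<Longrightarrow> pcas u (p @ q) w"
  by (induction p arbitrary: u) auto

lemma pawalk_verts_snoc: "pcas u p v \<Longrightarrow> pawalk_verts u (p @ [(v, w)]) = pawalk_verts u p @ [w]"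
  by (induction p arbitrary: u) auto

text \<open>A path from \<open>s\<close> to \<open>t\<close> avoiding the edge closes up with the
  arc \<open>(t, s)\<close> to a cycle. The path is neither empty nor a single arc, so the cycle has
  length at least three, as \<open>undirected_tree\<close> demands.\<close>

lemma undirected_tree_edge_bridge:
  assumes tree: "undirected_tree T" and st: "(s, t) \<in> parcs T"
  shows "(s, t) \<notin> (parcs T - {(s, t), (t, s)})\<^sup>*"
proof
  assume reach: "(s, t) \<in> (parcs T - {(s, t), (t, s)})\<^sup>*"
  interpret pair_graph T using tree by (simp add: undirected_tree_def)
  have ts: "(t, s) \<in> parcs T"
    using st sym_arcs by (simp add: symmetric_def sym_def)
  have "s \<noteq> t" using no_loops[OF st] by simp
  have sv: "s \<in> pverts T" and tv: "t \<in> pverts T"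
    using st in_arcsD1 in_arcsD2 by auto
  define H where "H = \<lparr>pverts = pverts T, parcs = parcs T - {(s, t), (t, s)}\<rparr>"
  interpret H: pair_wf_digraph H
    using in_arcsD1 in_arcsD2 by unfold_locales (auto simp: H_def)
  have "s \<rightarrow>\<^sup>*\<^bsub>with_proj H\<^esub> t"
    using reach sv H.reachable_conv'[of s t] by (simp add: H_def)
  then obtain p where "pre_digraph.apath (with_proj H) s p t"
    using H.reachable_apath by auto
  then have p: "set p \<subseteq> parcs T - {(s, t), (t, s)}" "pcas s p t" "distinct (pawalk_verts s p)"
    by (simp_all add: pre_digraph.apath_def pre_digraph.awalk_def cas_with_proj_eq
        awalk_verts_with_proj_eq H_def)
  have "p \<noteq> []"
    using p \<open>s \<noteq> t\<close> by auto
  have "pcas s (p @ [(t, s)]) s"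
    by (rule pcas_append[OF p(2)]) simp
  then have "awalk s (p @ [(t, s)]) s"
    using p(1) ts sv unfolding awalk_def cas_with_proj_eq by auto
  moreover have "distinct (tl (awalk_verts s (p @ [(t, s)])))"
    using p \<open>p \<noteq> []\<close> pawalk_verts_snoc[OF p(2), of s]
    by (cases p) (auto simp: awalk_verts_with_proj_eq)
  ultimately have "cycle (p @ [(t, s)])"
    unfolding cycle_def by blast
  moreover have "3 \<le> length (p @ [(t, s)])"
  proof (rule ccontr)
    assume "\<not> ?thesis"
    then have "p = [] \<or> (\<exists>e. p = [e])"
      by (cases p; cases "tl p") auto
    then show False
      using p \<open>s \<noteq> t\<close> by auto
  qed
  ultimately show False
    using tree unfolding undirected_tree_def by blast
qed

subsection \<open>Balanced separations from tree decompositions\<close>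

text \<open>Take \<open>J\<close> of least cardinality with sum above m/3: dropping one element
  brings the sum down to at most m/3, and that element contributed at most m/3.\<close>

lemma subfamily_sum_between:
  fixes f :: "'a \<Rightarrow> nat"
  assumes "finite I" and "\<And>i. i \<in> I \<Longrightarrow> 3 * f i \<le> m" and "m < 3 * sum f I"
  shows "\<exists>J\<subseteq>I. m < 3 * sum f J \<and> 3 * sum f J \<le> 2 * m"
proof -
  obtain J where J: "J \<subseteq> I" "m < 3 * sum f J"
    and min: "\<And>K. K \<subseteq> I \<Longrightarrow> m < 3 * sum f K \<Longrightarrow> card J \<le> card K"
    using ex_has_least_nat[of "\<lambda>J. J \<subseteq> I \<and> m < 3 * sum f J" I card] assms(3) by auto
  have fin: "finite J" using J(1) assms(1) finite_subset by blast
  obtain j where j: "j \<in> J" using J(2) by fastforce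
  have "card (J - {j}) < card J"
    using fin j by (rule card_Diff1_less)
  then have "3 * sum f (J - {j}) \<le> m"
    using min[of "J - {j}"] J(1) by fastforce
  moreover have "sum f J = f j + sum f (J - {j})"
    using fin j by (simp add: sum.remove)
  ultimately have "3 * sum f J \<le> 2 * m"
    using assms(2)[of j] j J(1) by auto
  then show ?thesis using J by blast
qed

text \<open>Cut the walk at its first visit to \<open>t\<close>; \<open>s\<close> is the node just
  before.\<close>

lemma rtrancl_avoiding_last:
  assumes "(x, t) \<in> E\<^sup>*" and "x \<noteq> t"
  shows "\<exists>s. (x, s) \<in> (E \<inter> (- {t}) \<times> (- {t}))\<^sup>* \<and> s \<noteq> t \<and> (s, t) \<in> E"
  using assms
proof (induction rule: converse_rtrancl_induct)
  case base
  then show ?case by simp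
next
  case (step x y)
  show ?case
  proof (cases "y = t")
    case True
    then show ?thesis using step by blast
  next
    case False
    then obtain s where s: "(y, s) \<in> (E \<inter> (- {t}) \<times> (- {t}))\<^sup>*" "s \<noteq> t" "(s, t) \<in> E"
      using step by blast
    have "(x, y) \<in> E \<inter> (- {t}) \<times> (- {t})"
      using step False by blast
    then show ?thesis using s by (meson converse_rtrancl_into_rtrancl)
  qed
qed

section \<open>Branches at a node of the decomposition tree\<close>

locale tree_decomposed_graph =
  fixes G :: "'a pair_pre_digraph" and T :: "'t pair_pre_digraph" and bag :: "'t \<Rightarrow> 'a set"
  assumes graph: "pair_graph G"
    and dec: "tree_decomposition G T bag"
begin

abbreviation nodes_of :: "'a \<Rightarrow> 't set" where
  "nodes_of v \<equiv> {t \<in> pverts T. v \<in> bag t}"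

abbreviation avoid :: "'t \<Rightarrow> 't rel" where
  "avoid t \<equiv> parcs T \<inter> (- {t}) \<times> (- {t})"

text \<open>The component of \<open>x\<close> in the tree minus \<open>t\<close>. In the degenerate
  case \<open>x = t\<close> it is \<open>{t}\<close>, since \<open>avoid t\<close> has no arc at
  \<open>t\<close>.\<close>

definition branch :: "'t \<Rightarrow> 't \<Rightarrow> 't set" where
  "branch t x = {y. (x, y) \<in> (avoid t)\<^sup>*}"

definition branch_part :: "'t \<Rightarrow> 't \<Rightarrow> 'a set" where
  "branch_part t x = (\<Union>y \<in> branch t x. bag y) - bag t"

lemma tree_T: "undirected_tree T"
  using dec by (simp add: tree_decomposition_def)

sublocale T: pair_graph T
  using tree_T by (simp add: undirected_tree_def)

lemma sym_T: "sym (parcs T)"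
  using T.sym_arcs by (simp add: symmetric_def)

lemma sym_avoid: "sym ((avoid t)\<^sup>*)"
  using sym_T by (intro sym_rtrancl) (auto simp: sym_def)

lemma T_connected: "x \<in> pverts T \<Longrightarrow> y \<in> pverts T \<Longrightarrow> (x, y) \<in> (parcs T)\<^sup>*"
  using tree_T connected_iff[OF T.pair_graph_axioms] by (simp add: undirected_tree_def)

lemma nodes_of_connected:
  assumes "v \<in> bag x" "v \<in> bag y" "x \<in> pverts T" "y \<in> pverts T"
  shows "(x, y) \<in> (parcs T \<inter> nodes_of v \<times> nodes_of v)\<^sup>*"
proof -
  have "v \<in> pverts G"
    using dec assms by (auto simp: tree_decomposition_def)
  then have "connected (with_proj T \<restriction> nodes_of v)"
    using dec by (simp add: tree_decomposition_def)
  then show ?thesis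
    using connected_induce_iff[OF sym_T] assms by blast
qed

lemma branch_self: "x \<in> branch t x"
  by (simp add: branch_def)

lemma branch_sym: "y \<in> branch t x \<Longrightarrow> x \<in> branch t y"
  using sym_avoid by (auto simp: branch_def dest: symD)

lemma branch_trans: "y \<in> branch t x \<Longrightarrow> z \<in> branch t y \<Longrightarrow> z \<in> branch t x"
  by (auto simp: branch_def)

lemma branch_eq: "y \<in> branch t x \<Longrightarrow> branch t y = branch t x"
  using branch_sym branch_trans by blast

lemma branch_avoids: "x \<noteq> t \<Longrightarrow> y \<in> branch t x \<Longrightarrow> y \<noteq> t"
  unfolding branch_def by (auto elim: rtranclE)

lemma branch_subset:
  assumes "x \<in> pverts T"
  shows "branch t x \<subseteq> pverts T"
proof -
  have "(x, y) \<in> (avoid t)\<^sup>* \<Longrightarrow> y \<in> pverts T" for y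
    by (induction rule: rtrancl_induct) (use assms T.in_arcsD2 in auto)
  then show ?thesis by (auto simp: branch_def)
qed

lemma branch_neighbour:
  assumes "t \<in> pverts T" "x \<in> pverts T" "x \<noteq> t"
  obtains s where "s \<in> branch t x" "s \<noteq> t" "(s, t) \<in> parcs T"
  using rtrancl_avoiding_last[OF T_connected[OF assms(2,1)] assms(3)] by (auto simp: branch_def)

text \<open>The nodes of \<open>v\<close> are connected and miss \<open>t\<close>, so they stay
  within one component of the tree minus \<open>t\<close>.\<close>

lemma nodes_of_subset_branch:
  assumes "t \<in> pverts T" "v \<in> branch_part t x" "x \<in> pverts T"
  shows "nodes_of v \<subseteq> branch t x"
proof
  fix z assume z: "z \<in> nodes_of v"
  obtain y where y: "y \<in> branch t x" "v \<in> bag y" "v \<notin> bag t"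
    using assms(2) by (auto simp: branch_part_def)
  have "y \<in> pverts T" using y branch_subset[OF assms(3)] by auto
  then have "(y, z) \<in> (parcs T \<inter> nodes_of v \<times> nodes_of v)\<^sup>*"
    using nodes_of_connected y z by auto
  moreover have "parcs T \<inter> nodes_of v \<times> nodes_of v \<subseteq> avoid t"
    using y by auto
  ultimately have "z \<in> branch t y"
    unfolding branch_def using rtrancl_mono by blast
  then show "z \<in> branch t x" using y branch_trans by blast
qed

lemma in_branch_part:
  assumes "y \<in> branch t x" "v \<in> bag y" "v \<notin> bag t"
  shows "v \<in> branch_part t x"
  using assms by (auto simp: branch_part_def)

lemma arc_common_bag:
  assumes "(u, v) \<in> parcs G"
  obtains c where "c \<in> pverts T" "u \<in> bag c" "v \<in> bag c"
  using dec assms by (auto simp: tree_decomposition_def)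

text \<open>Expresses that \<open>bag t\<close> separates each branch part from the rest: a bag
  containing both ends of the arc belongs to a node of the branch.\<close>

lemma branch_part_arc:
  assumes "t \<in> pverts T" "x \<in> pverts T" "u \<in> branch_part t x" "(u, v) \<in> parcs G"
  shows "v \<in> branch_part t x \<union> bag t"
proof -
  obtain c where c: "c \<in> pverts T" "u \<in> bag c" "v \<in> bag c"
    using arc_common_bag[OF assms(4)] .
  then have "c \<in> branch t x"
    using nodes_of_subset_branch[OF assms(1,3,2)] by auto
  then show ?thesis using c by (auto simp: branch_part_def)
qed

lemma bag_subset: "t \<in> pverts T \<Longrightarrow> bag t \<subseteq> pverts G"
  using dec by (auto simp: tree_decomposition_def)

lemma ex_bag: "v \<in> pverts G \<Longrightarrow> \<exists>t \<in> pverts T. v \<in> bag t"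
  using dec by (auto simp: tree_decomposition_def)

lemma branch_part_subset: "x \<in> pverts T \<Longrightarrow> branch_part t x \<subseteq> pverts G"
  using branch_subset bag_subset by (fastforce simp: branch_part_def)

lemma branch_part_eq: "y \<in> branch t x \<Longrightarrow> branch_part t y = branch_part t x"
  by (simp add: branch_part_def branch_eq)

text \<open>A common vertex has a node in both branches, which then coincide. The parts, not the
  branches, are assumed distinct because they are later collected in a set.\<close>

lemma branch_part_disjoint:
  assumes "t \<in> pverts T" "x \<in> pverts T" "y \<in> pverts T"
    and "branch_part t x \<noteq> branch_part t y"
  shows "branch_part t x \<inter> branch_part t y = {}"
proof (rule ccontr)
  assume "\<not> ?thesis"
  then obtain v where v: "v \<in> branch_part t x" "v \<in> branch_part t y" by blast
  obtain z where "z \<in> pverts T" "v \<in> bag z"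
    using v(1) branch_part_subset[OF assms(2)] ex_bag by blast
  then have "z \<in> branch t x" "z \<in> branch t y"
    using nodes_of_subset_branch assms v by blast+
  then show False using branch_part_eq assms(4) by metis
qed

lemma branch_avoids_edge:
  assumes "z \<in> branch t x"
  shows "(x, z) \<in> (parcs T - {(s, t), (t, s)})\<^sup>*"
proof -
  have "avoid t \<subseteq> parcs T - {(s, t), (t, s)}" by auto
  then show ?thesis
    using assms rtrancl_mono unfolding branch_def by blast
qed

text \<open>Neither branch uses the edge between \<open>s\<close> and \<open>t\<close>, so a common
  node would join \<open>s\<close> to \<open>t\<close> without this edge, which is a bridge.\<close>

lemma branches_disjoint:
  assumes "(s, t) \<in> parcs T"
  shows "branch t s \<inter> branch s t = {}"
proof (rule ccontr)
  assume "\<not> ?thesis"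
  then obtain z where z: "z \<in> branch t s" "z \<in> branch s t" by blast
  have "(s, z) \<in> (parcs T - {(s, t), (t, s)})\<^sup>*"
    using branch_avoids_edge[OF z(1)] .
  moreover have "(z, t) \<in> (parcs T - {(s, t), (t, s)})\<^sup>*"
    using branch_avoids_edge[OF branch_sym[OF z(2)], of t] by (simp add: insert_commute)
  ultimately show False
    using undirected_tree_edge_bridge[OF tree_T assms] rtrancl_trans by metis
qed

text \<open>
  The only neighbour of \<open>t\<close> in the branch of \<open>s\<close> is \<open>s\<close>, so the nodes of a vertex lying both in
  this branch and at \<open>t\<close> pass through \<open>s\<close>.
\<close>

lemma in_bag_of_neighbour:
  assumes "(s, t) \<in> parcs T" "c \<in> branch t s" "v \<in> bag c" "v \<in> bag t"
  shows "v \<in> bag s"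
proof -
  let ?E = "parcs T - {(s, t), (t, s)}" and ?F = "parcs T \<inter> nodes_of v \<times> nodes_of v"
  have st: "s \<in> pverts T" "t \<in> pverts T" "s \<noteq> t"
    using assms(1) T.in_arcsD1 T.in_arcsD2 T.no_loops by fastforce+
  have c: "c \<in> pverts T" "c \<noteq> t"
    using assms(2) branch_subset branch_avoids st by blast+
  obtain r where r: "(c, r) \<in> (?F \<inter> (- {t}) \<times> (- {t}))\<^sup>*" "r \<noteq> t" "(r, t) \<in> ?F"
    using rtrancl_avoiding_last[OF nodes_of_connected[OF assms(3,4) c(1) st(2)] c(2)] by blast
  have "(c, r) \<in> (avoid t)\<^sup>*"
    by (rule set_mp[OF rtrancl_mono r(1)]) auto
  then have "r \<in> branch t s"
    using assms(2) branch_trans by (auto simp: branch_def)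
  then have "(s, r) \<in> ?E\<^sup>*"
    by (rule branch_avoids_edge)
  have "r = s"
  proof (rule ccontr)
    assume "r \<noteq> s"
    then have "(r, t) \<in> ?E" using r by auto
    then have "(s, t) \<in> ?E\<^sup>*"
      using \<open>(s, r) \<in> ?E\<^sup>*\<close> by (rule rtrancl_into_rtrancl[rotated])
    then show False
      using undirected_tree_edge_bridge[OF tree_T assms(1)] by simp
  qed
  then show ?thesis using r(3) by blast
qed

text \<open>If every branch part has at most m/3 vertices, some union \<open>A\<close> of parts has
  more than m/3 and at most 2m/3. More than m vertices lie outside \<open>bag t\<close>, so the
  remainder \<open>B\<close> also exceeds m/3.\<close>

lemma large_branch_or_separation:
  assumes small: "card (bag t) < m" and big: "2 * m \<le> card (pverts G)"
    and t: "t \<in> pverts T"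
    and nosep: "\<not> (\<exists>X A B. pverts G = X \<union> A \<union> B \<and> X \<inter> A = {} \<and> X \<inter> B = {} \<and> A \<inter> B = {} \<and>
      parcs G \<inter> A \<times> B = {} \<and> card X < m \<and> m < 3 * card A \<and> m < 3 * card B)"
  shows "\<exists>x \<in> pverts T - {t}. m < 3 * card (branch_part t x)"
proof (rule ccontr)
  assume no: "\<not> ?thesis"
  interpret G: pair_graph G by (rule graph)
  \<comment> \<open>A set of parts, not a family indexed by nodes: all nodes of one branch give the
    same part, which must be counted once.\<close>
  define I where "I = branch_part t ` (pverts T - {t})"
  have finI: "finite I" by (simp add: I_def)
  have disj: "A \<in> I \<Longrightarrow> B \<in> I \<Longrightarrow> A \<noteq> B \<Longrightarrow> A \<inter> B = {}" for A B
    using branch_part_disjoint t by (auto simp: I_def)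
  have sub: "A \<in> I \<Longrightarrow> A \<subseteq> pverts G - bag t" for A
    using branch_part_subset by (auto simp: I_def) (auto simp: branch_part_def)
  have fin: "A \<in> I \<Longrightarrow> finite A" for A
    using sub by (meson finite_Diff finite_subset G.finite_verts pair_fin_digraph.axioms G.pair_finite_verts)
  have card_Un: "card (\<Union>J) = sum card J" if "J \<subseteq> I" for J
    using that fin disj
    by (intro card_Union_disjoint) (simp_all add: pairwise_def disjnt_def subset_iff)
  have cover: "\<Union>I = pverts G - bag t"
  proof
    show "\<Union>I \<subseteq> pverts G - bag t" using sub by blast
    show "pverts G - bag t \<subseteq> \<Union>I"
    proof
      fix v assume v: "v \<in> pverts G - bag t"
      then obtain x where "x \<in> pverts T" "v \<in> bag x" using ex_bag by blast
      then show "v \<in> \<Union>I"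
        using v by (auto simp: I_def intro!: bexI[of _ x] in_branch_part[OF branch_self])
    qed
  qed
  have "card (bag t) + card (pverts G - bag t) = card (pverts G)"
    using bag_subset[OF t] by (metis G.pair_finite_verts card_Un_disjoint finite_Diff finite_subset Diff_disjoint Un_Diff_cancel sup.absorb2)
  then have tot: "m < card (\<Union>I)" using small big cover by simp
  then have "m < 3 * sum card I" using card_Un[of I] by simp
  then obtain J where J: "J \<subseteq> I" "m < 3 * sum card J" "3 * sum card J \<le> 2 * m"
    using subfamily_sum_between[OF finI, of card m] no by (auto simp: I_def not_less)
  define A where "A = \<Union>J"
  define B where "B = pverts G - bag t - A"
  have A_sub: "A \<subseteq> pverts G - bag t" using J sub by (auto simp: A_def)
  have cA: "m < 3 * card A" "3 * card A \<le> 2 * m" using J card_Un by (auto simp: A_def)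
  have "card B = card (pverts G - bag t) - card A"
    unfolding B_def using A_sub G.pair_finite_verts by (intro card_Diff_subset) (auto intro: finite_subset)
  then have cB: "m < 3 * card B" using cA tot cover by simp
  have "parcs G \<inter> A \<times> B = {}"
  proof (rule ccontr)
    assume "\<not> ?thesis"
    then obtain u v where uv: "(u, v) \<in> parcs G" "u \<in> A" "v \<in> B" by blast
    then obtain x where x: "x \<in> pverts T" "branch_part t x \<in> J" "u \<in> branch_part t x"
      using J(1) by (auto simp: A_def I_def)
    then have "v \<in> branch_part t x \<union> bag t" using branch_part_arc t uv by blast
    then show False using x uv by (auto simp: A_def B_def)
  qed
  moreover have "pverts G = bag t \<union> A \<union> B" "bag t \<inter> A = {}" "bag t \<inter> B = {}" "A \<inter> B = {}"
    using A_sub bag_subset[OF t] by (auto simp: B_def)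
  ultimately show False
    using nosep small cA cB by blast
qed

text \<open>
  Orient every node towards a branch carrying many vertices. Minimising the size of that branch
  yields an edge oriented both ways, and its adhesion set separates.
\<close>

theorem balanced_separation:
  assumes small: "\<And>t. t \<in> pverts T \<Longrightarrow> card (bag t) < m" and big: "2 * m \<le> card (pverts G)"
  shows "\<exists>X A B. pverts G = X \<union> A \<union> B \<and> X \<inter> A = {} \<and> X \<inter> B = {} \<and> A \<inter> B = {} \<and>
      parcs G \<inter> A \<times> B = {} \<and> card X < m \<and> m < 3 * card A \<and> m < 3 * card B"
proof (rule ccontr)
  assume nosep: "\<not> ?thesis"
  interpret G: pair_graph G by (rule graph)
  have large: "\<exists>x \<in> pverts T - {t}. m < 3 * card (branch_part t x)" if "t \<in> pverts T" for t
    using large_branch_or_separation[OF small[OF that] big that nosep] .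
  define Q where "Q = (\<lambda>(t, x). t \<in> pverts T \<and> x \<in> pverts T - {t} \<and> m < 3 * card (branch_part t x))"
  have "\<exists>t. t \<in> pverts T"
    using tree_T connected_iff[OF T.pair_graph_axioms] by (auto simp: undirected_tree_def)
  then have "\<exists>tx. Q tx" using large by (fastforce simp: Q_def)
  then obtain t x where Q: "Q (t, x)"
    and min: "\<And>t' x'. Q (t', x') \<Longrightarrow> card (branch t x) \<le> card (branch t' x')"
    using ex_has_least_nat[of Q _ "\<lambda>(t, x). card (branch t x)"] by fastforce
  have tx: "t \<in> pverts T" "x \<in> pverts T" "x \<noteq> t" "m < 3 * card (branch_part t x)"
    using Q by (auto simp: Q_def)
  obtain s where s: "s \<in> branch t x" "s \<noteq> t" "(s, t) \<in> parcs T"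
    using branch_neighbour[OF tx(1-3)] .
  have bs: "branch t s = branch t x" "branch_part t s = branch_part t x"
    using s branch_eq branch_part_eq by auto
  have sv: "s \<in> pverts T" using s branch_subset tx by blast
  obtain y where y: "y \<in> pverts T" "y \<noteq> s" "m < 3 * card (branch_part s y)"
    using large[OF sv] by blast
  \<comment> \<open>Otherwise the large branch at \<open>s\<close> points away from
    \<open>t\<close>. It then lies inside \<open>branch t s\<close> and misses \<open>s\<close>, so
    it is strictly smaller, against the choice of \<open>(t, x)\<close>.\<close>
  have t_in: "t \<in> branch s y"
  proof (rule ccontr)
    assume nt: "t \<notin> branch s y"
    obtain r where r: "r \<in> branch s y" "r \<noteq> s" "(r, s) \<in> parcs T"
      using branch_neighbour[OF sv y(1,2)] .
    have "branch s y \<subseteq> branch t s"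
    proof
      fix z assume "z \<in> branch s y"
      then have "(r, z) \<in> (avoid s)\<^sup>*"
        using r branch_eq by (auto simp: branch_def)
      \<comment> \<open>The second conjunct carries the induction: every node met lies in
        \<open>branch s y\<close>, which misses \<open>t\<close>, so each arc of the walk avoids
        \<open>t\<close>.\<close>
      then have "(r, z) \<in> (avoid t)\<^sup>* \<and> z \<in> branch s y"
      proof (induction rule: rtrancl_induct)
        case base
        then show ?case using r by simp
      next
        case (step a b)
        then have "b \<in> branch s y"
          using rtrancl_into_rtrancl[of y a "avoid s" b] by (simp add: branch_def)
        moreover have "a \<noteq> t" "b \<noteq> t" using nt step calculation by auto
        then have "(a, b) \<in> avoid t" using step by auto
        ultimately show ?case
          using step rtrancl_into_rtrancl[of r a "avoid t" b] by simp
      qed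
      moreover have "(s, r) \<in> avoid t"
        using r nt s sym_T by (auto dest: symD)
      ultimately show "z \<in> branch t s"
        by (auto simp: branch_def intro: converse_rtrancl_into_rtrancl)
    qed
    moreover have "s \<notin> branch s y" using branch_avoids[OF y(2)] by blast
    ultimately have "branch s y \<subset> branch t x"
      using branch_self[of s t] bs by blast
    moreover have "finite (branch t x)"
      using branch_subset[OF tx(2)] T.pair_finite_verts finite_subset by blast
    ultimately have "card (branch s y) < card (branch t x)"
      by (simp add: psubset_card_mono)
    then show False using min[of s y] y sv by (simp add: Q_def)
  qed
  have yt: "branch_part s y = branch_part s t" "branch s y = branch s t"
    using t_in branch_eq branch_part_eq by auto
  \<comment> \<open>\<open>X\<close> is the adhesion set of the edge, \<open>A\<close> the large
    part on the side of \<open>s\<close>. Taking all other vertices as \<open>B\<close> makes the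
    cover automatic; \<open>B\<close> is large because it contains
    \<open>branch_part s t\<close>.\<close>
  define X where "X = bag t \<inter> bag s"
  define A where "A = branch_part t s"
  define B where "B = pverts G - X - A"
  have A_sub: "A \<subseteq> pverts G" "A \<inter> bag t = {}"
    using branch_part_subset[OF sv] by (auto simp: A_def branch_part_def)
  have finB: "finite B" by (simp add: B_def)
  have "branch_part s t \<subseteq> B"
  proof
    fix v assume v: "v \<in> branch_part s t"
    then have vV: "v \<in> pverts G" using branch_part_subset tx by blast
    then obtain z where z: "z \<in> nodes_of v" using ex_bag by blast
    have "v \<notin> A"
    proof
      assume "v \<in> A"
      then have "z \<in> branch t s" "z \<in> branch s t"
        using z v nodes_of_subset_branch sv tx unfolding A_def by blast+
      then show False using branches_disjoint s(3) by blast
    qed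
    then show "v \<in> B" using v vV by (auto simp: B_def X_def branch_part_def)
  qed
  then have "card (branch_part s t) \<le> card B" using finB card_mono by blast
  then have cB: "m < 3 * card B" using y yt by simp
  have cA: "m < 3 * card A" using tx bs by (simp add: A_def)
  have "card X \<le> card (bag t)"
    unfolding X_def using bag_subset[OF tx(1)] G.pair_finite_verts
    by (intro card_mono) (auto intro: finite_subset)
  then have cX: "card X < m" using small[OF tx(1)] by simp
  have "parcs G \<inter> A \<times> B = {}"
  proof (rule ccontr)
    assume "\<not> ?thesis"
    then obtain u v where uv: "(u, v) \<in> parcs G" "u \<in> A" "v \<in> B" by blast
    obtain c where c: "c \<in> pverts T" "u \<in> bag c" "v \<in> bag c"
      using arc_common_bag[OF uv(1)] .
    have c_in: "c \<in> branch t s"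
      using nodes_of_subset_branch[OF tx(1) _ sv] uv(2) c unfolding A_def by blast
    \<comment> \<open>Being outside \<open>A\<close>, the end \<open>v\<close> can share a bag of
      this branch only if it lies in \<open>bag t\<close>; then it also lies in
      \<open>bag s\<close>, hence in \<open>X\<close>.\<close>
    have "v \<in> bag t"
      using in_branch_part[OF c_in c(3)] uv(3) by (auto simp: A_def B_def)
    then have "v \<in> X"
      using in_bag_of_neighbour[OF s(3) c_in c(3)] by (simp add: X_def)
    then show False using uv(3) by (simp add: B_def)
  qed
  moreover have "pverts G = X \<union> A \<union> B" "X \<inter> A = {}" "X \<inter> B = {}" "A \<inter> B = {}"
    using A_sub bag_subset[OF tx(1)] by (auto simp: B_def X_def)
  ultimately show False
    using nosep cX cA cB by blast
qed

end

subsection \<open>Cross-intersecting families\<close>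

text \<open>\<open>B\<close> is disjoint from the family of \<open>l\<close>-subsets of
  \<open>U - a\<close>, which the binomial coefficient on the left counts.\<close>

lemma card_family_meeting:
  assumes "finite U" "a \<subseteq> U" "B \<subseteq> {b. b \<subseteq> U \<and> card b = l}" "\<And>b. b \<in> B \<Longrightarrow> a \<inter> b \<noteq> {}"
  shows "card B + ((card U - card a) choose l) \<le> card U choose l"
proof -
  let ?D = "{b. b \<subseteq> U - a \<and> card b = l}" and ?K = "{b. b \<subseteq> U \<and> card b = l}"
  have finK: "finite ?K" using assms(1) by simp
  have "card ?D = (card U - card a) choose l"
    using assms(1,2) by (simp add: n_subsets card_Diff_subset finite_subset)
  moreover have "B \<inter> ?D = {}" using assms(4) by blast
  then have "card (B \<union> ?D) = card B + card ?D"
    using assms(1) finite_subset[OF assms(3) finK] by (intro card_Un_disjoint) auto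
  moreover have "card (B \<union> ?D) \<le> card ?K"
    using assms(3) by (intro card_mono finK) auto
  ultimately show ?thesis
    using n_subsets[OF assms(1), of l] by simp
qed

text \<open>Passage to the link of \<open>x\<close>: removing the common element is injective and
  lowers both the ground set and the set size by one.\<close>

lemma card_remove_common_element:
  assumes "finite U" "x \<in> U" "B \<subseteq> {b. b \<subseteq> U \<and> card b = k}" "\<And>b. b \<in> B \<Longrightarrow> x \<in> b"
  obtains B' where "card B' = card B" "B' \<subseteq> {b. b \<subseteq> U - {x} \<and> card b = k - 1}"
    "\<And>c. c \<in> B' \<Longrightarrow> insert x c \<in> B"
proof
  let ?f = "\<lambda>b. b - {x}"
  have "inj_on ?f B"
    using assms(4) by (auto intro!: inj_onI)
  then show "card (?f ` B) = card B" by (rule card_image)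
  show "?f ` B \<subseteq> {b. b \<subseteq> U - {x} \<and> card b = k - 1}"
    using assms by (fastforce simp: card_Diff_singleton)
  show "insert x c \<in> B" if "c \<in> ?f ` B" for c
    using that assms(4) by (auto simp: insert_absorb)
qed

lemma card_family_through:
  assumes "finite U" "x \<in> U" "B \<subseteq> {b. b \<subseteq> U \<and> card b = k}" "\<And>b. b \<in> B \<Longrightarrow> x \<in> b"
  shows "card B \<le> (card U - 1) choose (k - 1)"
proof -
  obtain B' where B': "card B' = card B" "B' \<subseteq> {b. b \<subseteq> U - {x} \<and> card b = k - 1}"
    using card_remove_common_element[OF assms] .
  have "card B' \<le> card {b. b \<subseteq> U - {x} \<and> card b = k - 1}"
    using assms(1) B'(2) by (intro card_mono) auto
  also have "\<dots> = (card U - 1) choose (k - 1)"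
    using assms(1,2) by (simp add: n_subsets)
  finally show ?thesis using B'(1) by simp
qed

text \<open>Since \<open>x\<close> is not in \<open>a\<close>, the link of \<open>x\<close> still
  meets \<open>a\<close>, and \<open>card_family_meeting\<close> applies inside
  \<open>U - {x}\<close>.\<close>

lemma card_family_through_meeting:
  assumes "finite U" "x \<in> U" "B \<subseteq> {b. b \<subseteq> U \<and> card b = k}" "\<And>b. b \<in> B \<Longrightarrow> x \<in> b"
    and "a \<subseteq> U" "x \<notin> a" "\<And>b. b \<in> B \<Longrightarrow> a \<inter> b \<noteq> {}"
  shows "card B + ((card U - 1 - card a) choose (k - 1)) \<le> (card U - 1) choose (k - 1)"
proof -
  obtain B' where B': "card B' = card B" "B' \<subseteq> {b. b \<subseteq> U - {x} \<and> card b = k - 1}"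
    "\<And>c. c \<in> B' \<Longrightarrow> insert x c \<in> B"
    using card_remove_common_element[OF assms(1-4)] by metis
  have "a \<inter> c \<noteq> {}" if "c \<in> B'" for c
    using assms(7)[OF B'(3)[OF that]] assms(6) by auto
  then have "card B' + ((card (U - {x}) - card a) choose (k - 1)) \<le> card (U - {x}) choose (k - 1)"
    using B'(2) assms(1,5,6) by (intro card_family_meeting) auto
  then show ?thesis
    using B'(1) assms(1,2) by (simp add: card_Diff_singleton)
qed

section \<open>Numerical consequences of the binomial ratio\<close>

lemma binomial_ratio_le_power:
  assumes "2 * k \<le> n"
  shows "real ((n - k) choose k) \<le> (1 - k / n) ^ k * real (n choose k)"
proof -
  have "real ((n - k) choose k) = (\<Prod>i<k. real (n - k - i) / real (k - i))"
    using assms by (simp add: binomial_altdef_of_nat atLeast0LessThan)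
  also have "\<dots> \<le> (\<Prod>i<k. (1 - k / n) * (real (n - i) / real (k - i)))"
  proof (rule prod_mono, safe)
    fix i assume "i < k"
    then have i: "i < k" "real (n - k - i) = real n - real k - real i" "real (n - i) = real n - real i" "0 < real n"
      using assms by auto
    \<comment> \<open>Factor by factor, (n - k - i) / (n - i) = 1 - k / (n - i) \<le> 1 - k /
      n.\<close>
    have "real (n - k - i) \<le> (1 - k / n) * real (n - i)"
      using i by (simp add: field_simps)
    then show "real (n - k - i) / real (k - i) \<le> (1 - k / n) * (real (n - i) / real (k - i))"
      using i(1) by (simp add: divide_right_mono)
  qed simp
  also have "\<dots> = (1 - k / n) ^ k * real (n choose k)"
    using assms unfolding prod.distrib by (simp add: binomial_altdef_of_nat atLeast0LessThan)
  finally show ?thesis .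
qed

text \<open>
  \<open>2 / 3 \<le> (1 - k / n) ^ k\<close>, while \<open>(1 - k / n) ^ k * (1 + k\<^sup>2 / n) \<le> (1 - k\<^sup>2 / n\<^sup>2) ^ k \<le> 1\<close> by
  Bernoulli's inequality.
\<close>

lemma binomial_ratio_imp_square_le:
  assumes "2 * k \<le> n" "0 < n" "2 * (n choose k) \<le> 3 * ((n - k) choose k)"
  shows "2 * k ^ 2 \<le> n"
proof -
  define x where "x = real k / real n"
  have x: "0 \<le> x" "x \<le> 1" using assms(1,2) by (auto simp: x_def)
  have pos: "0 < real (n choose k)" using assms(1) by simp
  have "2 * real (n choose k) \<le> 3 * real ((n - k) choose k)"
    using of_nat_mono[OF assms(3), where 'a = real] by simp
  also have "\<dots> \<le> (3 * (1 - x) ^ k) * real (n choose k)"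
    using binomial_ratio_le_power[OF assms(1)] by (simp add: x_def)
  finally have *: "2 \<le> 3 * (1 - x) ^ k" using pos by simp
  have "1 + real k * x \<le> (1 + x) ^ k"
    using Bernoulli_inequality[of x k] x by simp
  then have "2 * (1 + real k * x) \<le> (3 * (1 - x) ^ k) * (1 + x) ^ k"
    using * x by (intro mult_mono) auto
  also have "\<dots> = 3 * (1 - x ^ 2) ^ k"
    by (simp add: power_mult_distrib[symmetric] power2_eq_square algebra_simps)
  also have "\<dots> \<le> 3"
    using x power_le_one[of x 2] power_le_one[of "1 - x ^ 2" k] by simp
  finally have "2 * (real k * real k) \<le> real n"
    using assms(2) by (simp add: field_simps x_def)
  then have "real (2 * k ^ 2) \<le> real n" by (simp add: power2_eq_square)
  then show ?thesis by (simp only: of_nat_le_iff)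
qed

text \<open>For k \<ge> 3 this follows from 2 k^2 \<le> n. For k = 2 that bound gives only n \<ge>
  8, and the ratio hypothesis itself excludes the values 8 to 11.\<close>

lemma binomial_ratio_imp_six_le:
  assumes "2 * k + 1 \<le> n" "2 \<le> k" "2 * (n choose k) \<le> 3 * ((n - k) choose k)"
  shows "6 * k \<le> n"
proof (cases "k = 2")
  case True
  have "8 \<le> n" using binomial_ratio_imp_square_le[of k n] assms True by simp
  show ?thesis
  proof (rule ccontr)
    assume "\<not> ?thesis"
    then have "n = 8 \<or> n = 9 \<or> n = 10 \<or> n = 11" using True \<open>8 \<le> n\<close> by auto
    then show False using assms(3) True by (auto simp: choose_two)
  qed
next
  case False
  then have "3 * k \<le> k * k" using assms(2) by simp
  moreover have "2 * (k * k) \<le> n"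
    using binomial_ratio_imp_square_le[of k n] assms by (simp add: power2_eq_square)
  ultimately show ?thesis by linarith
qed

text \<open>Absorption turns k times each binomial coefficient of the hypothesis into n,
  respectively n - k, times the reduced one; then use n - k \<le> n.\<close>

lemma binomial_ratio_pred:
  assumes "0 < k" "k \<le> n" "2 * (n choose k) \<le> 3 * ((n - k) choose k)"
  shows "2 * ((n - 1) choose (k - 1)) \<le> 3 * ((n - 1 - k) choose (k - 1))"
proof -
  let ?c = "(n - 1) choose (k - 1)" and ?c' = "(n - 1 - k) choose (k - 1)"
  have "n * (2 * ?c) = k * (2 * (n choose k))"
    using times_binomial_minus1_eq[OF assms(1), of n] by simp
  also have "\<dots> \<le> k * (3 * ((n - k) choose k))"
    using assms(3) by (rule mult_le_mono2)
  also have "\<dots> = (n - k) * (3 * ?c')"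
    using times_binomial_minus1_eq[OF assms(1), of "n - k"] by (simp add: diff_commute)
  also have "\<dots> \<le> n * (3 * ?c')" by simp
  finally show ?thesis using assms(1,2) by simp
qed

section \<open>Cross-intersecting families of \<open>k\<close>-sets under the ratio
  hypothesis\<close>

locale kneser_ratio =
  fixes U :: "'a set" and n k :: nat
  assumes finU: "finite U" and cardU: "card U = n"
    and n: "2 * k + 1 \<le> n" and k: "2 \<le> k"
    and ratio: "2 * (n choose k) \<le> 3 * ((n - k) choose k)"
begin

definition ksets :: "'a set set" where
  "ksets = {a. a \<subseteq> U \<and> card a = k}"

text \<open>\<open>B\<close> misses the \<open>k\<close>-sets disjoint from \<open>a\<close>, which
  by \<open>ratio\<close> make up at least two thirds of all \<open>k\<close>-sets.\<close>

lemma cross_intersecting_card: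
  assumes "a \<in> ksets" "B \<subseteq> ksets" "\<And>b. b \<in> B \<Longrightarrow> a \<inter> b \<noteq> {}"
  shows "3 * card B \<le> n choose k"
proof -
  have "card B + ((card U - card a) choose k) \<le> card U choose k"
    using assms by (intro card_family_meeting finU) (auto simp: ksets_def)
  then show ?thesis using assms(1) ratio cardU by (simp add: ksets_def)
qed

text \<open>
  Either some element \<open>x\<close> of \<open>a\<^sub>0 \<in> A\<close> lies in all members of \<open>A\<close>, or, for each \<open>x \<in> a\<^sub>0\<close>, the
  members of \<open>B\<close> through \<open>x\<close> all meet some set not containing \<open>x\<close>; and every member of \<open>B\<close>
  contains some \<open>x \<in> a\<^sub>0\<close>.
\<close>

lemma cross_intersecting_min_card:
  assumes A: "A \<subseteq> ksets" "A \<noteq> {}" and B: "B \<subseteq> ksets"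
    and cross: "\<And>a b. a \<in> A \<Longrightarrow> b \<in> B \<Longrightarrow> a \<inter> b \<noteq> {}"
  shows "6 * card A \<le> n choose k \<or> 6 * card B \<le> n choose k"
proof -
  let ?N = "n choose k" and ?c = "(n - 1) choose (k - 1)"
  have absorb: "k * ?N = n * ?c"
    using times_binomial_minus1_eq[of k n] k by simp
  show ?thesis
  proof (cases "\<exists>x\<in>U. \<forall>a\<in>A. x \<in> a")
    case True
    then obtain x where "x \<in> U" "\<And>a. a \<in> A \<Longrightarrow> x \<in> a" by blast
    then have "card A \<le> ?c"
      using card_family_through[OF finU, of x A k] A(1) cardU by (simp add: ksets_def)
    \<comment> \<open>By absorption \<open>?c\<close> is the fraction k/n of \<open>?N\<close>,
      hence at most a sixth of it.\<close>
    have "k * (6 * card A) \<le> (6 * k) * ?c"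
      using \<open>card A \<le> ?c\<close> by simp
    also have "\<dots> \<le> n * ?c"
      using binomial_ratio_imp_six_le[OF n k ratio] by simp
    finally have "k * (6 * card A) \<le> k * ?N" using absorb by simp
    then show ?thesis using k by (simp only: mult_le_cancel1) simp
  next
    case False
    obtain a where a: "a \<in> A" using A(2) by blast
    then have aU: "a \<subseteq> U" "card a = k" using A(1) by (auto simp: ksets_def)
    have fin_a: "finite a" using aU finU finite_subset by blast
    have through: "3 * card {b \<in> B. x \<in> b} \<le> ?c" if "x \<in> a" for x
    proof -
      have "x \<in> U" using that aU(1) by (rule subsetD[rotated])
      then obtain a' where a': "a' \<in> A" "x \<notin> a'" using False by auto
      have a'U: "a' \<subseteq> U" "card a' = k" using a' A(1) by (auto simp: ksets_def)
      have "{b \<in> B. x \<in> b} \<subseteq> {b. b \<subseteq> U \<and> card b = k}" using B by (auto simp: ksets_def)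
      then have "card {b \<in> B. x \<in> b} + ((card U - 1 - card a') choose (k - 1))
          \<le> (card U - 1) choose (k - 1)"
        using \<open>x \<in> U\<close> a' a'U cross[OF a'(1)] by (intro card_family_through_meeting finU) auto
      then have "card {b \<in> B. x \<in> b} + ((n - 1 - k) choose (k - 1)) \<le> ?c"
        using a'U cardU by simp
      then show ?thesis
        using binomial_ratio_pred[of k n] n k ratio by simp
    qed
    have "B \<subseteq> (\<Union>x\<in>a. {b \<in> B. x \<in> b})" using cross[OF a] by blast
    moreover have "finite B"
      by (rule finite_subset[OF B]) (simp add: ksets_def finU)
    ultimately have "card B \<le> card (\<Union>x\<in>a. {b \<in> B. x \<in> b})"
      using fin_a by (intro card_mono) auto
    also have "\<dots> \<le> (\<Sum>x\<in>a. card {b \<in> B. x \<in> b})"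
      using fin_a by (rule card_UN_le)
    finally have "3 * card B \<le> (\<Sum>x\<in>a. 3 * card {b \<in> B. x \<in> b})"
      by (simp add: sum_distrib_left[symmetric])
    also have "\<dots> \<le> k * ?c"
      using sum_bounded_above[of a "\<lambda>x. 3 * card {b \<in> B. x \<in> b}" ?c] through aU by simp
    \<comment> \<open>Thus 3 |B| \<le> k \<open>?c\<close> = (k^2 / n) \<open>?N\<close>, and 2 k^2
      \<le> n bounds this by half of \<open>?N\<close>.\<close>
    finally have "n * (6 * card B) \<le> 2 * (n * (k * ?c))" by simp
    also have "\<dots> = (2 * k ^ 2) * ?N"
      using absorb by (simp add: power2_eq_square mult.left_commute)
    also have "\<dots> \<le> n * ?N"
      using binomial_ratio_imp_square_le[of k n] n ratio by simp
    finally show ?thesis using n by (simp only: mult_le_cancel1) simp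
  qed
qed

text \<open>One family has at most a third of all \<open>k\<close>-sets, the smaller one at most a
  sixth; together this is one half.\<close>

lemma cross_intersecting_card_add:
  assumes "A \<subseteq> ksets" "A \<noteq> {}" "B \<subseteq> ksets" "B \<noteq> {}"
    and "\<And>a b. a \<in> A \<Longrightarrow> b \<in> B \<Longrightarrow> a \<inter> b \<noteq> {}"
  shows "3 * card A \<le> n choose k" "3 * card B \<le> n choose k"
    "2 * (card A + card B) \<le> n choose k"
proof -
  show A: "3 * card A \<le> n choose k" and B: "3 * card B \<le> n choose k"
    using cross_intersecting_card assms by (metis ex_in_conv subsetD Int_commute)+
  show "2 * (card A + card B) \<le> n choose k"
    using cross_intersecting_min_card[OF assms(1,2,3,5)] A B by auto
qed

end

subsection \<open>The star decomposition\<close>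

definition star :: "nat \<Rightarrow> nat pair_pre_digraph" where
  "star m = \<lparr>pverts = {0..m}, parcs = ({0} \<times> {1..m}) \<union> ({1..m} \<times> {0})\<rparr>"

lemma undirected_tree_star: "undirected_tree (star m)"
proof -
  have graph: "pair_graph (star m)"
    by unfold_locales (auto simp: star_def symmetric_def sym_def)
  have "(x, y) \<in> (parcs (star m))\<^sup>*" if "x \<le> m" "y \<le> m" for x y
  proof -
    have "(x, 0) \<in> (parcs (star m))\<^sup>*"
      using that by (cases "x = 0") (auto simp: star_def)
    moreover have "(0, y) \<in> (parcs (star m))\<^sup>*"
      using that by (cases "y = 0") (auto simp: star_def)
    ultimately show ?thesis by (rule rtrancl_trans)
  qed
  then have conn: "connected (with_proj (star m))"
    unfolding connected_iff[OF graph] by (auto simp: star_def)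
  have False if cyc: "pre_digraph.cycle (with_proj (star m)) p" and len: "3 \<le> length p" for p
  proof -
    obtain u where "pre_digraph.awalk (with_proj (star m)) u p u"
      and dist: "distinct (tl (pawalk_verts u p))"
      using cyc by (auto simp: pre_digraph.cycle_def awalk_verts_with_proj_eq)
    then have p: "set p \<subseteq> parcs (star m)" "pcas u p u"
      by (auto simp: pre_digraph.awalk_def cas_with_proj_eq)
    obtain e f g r where "p = e # f # g # r"
      using len by (auto simp: numeral_3_eq_3 Suc_le_length_iff)
    then obtain b c d where eq: "p = (u, b) # (b, c) # (c, d) # r" and r: "pcas d r u"
      using p(2) by (cases e; cases f; cases g) auto
    have "pcas x q y \<Longrightarrow> x \<in> set (pawalk_verts x q) \<and> y \<in> set (pawalk_verts x q)" for x y :: nat and q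
      by (induction q arbitrary: x) auto
    then have "u \<in> set (pawalk_verts d r)" "d \<in> set (pawalk_verts d r)"
      using r by blast+
    \<comment> \<open>Arcs alternate between the centre and the leaves. If \<open>u\<close> is the
      centre then \<open>c = u\<close>, otherwise \<open>b = d = 0\<close>; either way a vertex
      repeats after the start.\<close>
    then show False
      using p(1) dist by (auto simp: eq star_def)
  qed
  then show ?thesis
    using graph conn unfolding undirected_tree_def by blast
qed

text \<open>Every arc has an end in \<open>P\<close>, so the centre or a leaf bag contains both of
  its ends. The nodes of a vertex in \<open>P\<close> are joined through the centre; any other
  vertex occurs at exactly one leaf.\<close>

lemma star_decomposition:
  assumes graph: "pair_graph G" and P: "P \<subseteq> pverts G"
    and indep: "parcs G \<inter> (pverts G - P) \<times> (pverts G - P) = {}"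
    and q: "bij_betw q {1..m} (pverts G - P)"
  shows "tree_decomposition G (star m)
    (\<lambda>i. if i = 0 then P else insert (q i) {p \<in> P. (p, q i) \<in> parcs G})"
    (is "tree_decomposition G _ ?bag")
proof -
  interpret pair_graph G by (rule graph)
  have symG: "(v, u) \<in> parcs G" if "(u, v) \<in> parcs G" for u v
    using that sym_arcs by (simp add: symmetric_def sym_def)
  have symS: "sym (parcs (star m))" by (auto simp: star_def sym_def)
  have q_out: "q i \<in> pverts G - P" if "i \<in> {1..m}" for i
    using q that by (auto simp: bij_betw_def)
  have q_surj: "\<exists>i\<in>{1..m}. v = q i" if "v \<in> pverts G" "v \<notin> P" for v
    using q that by (auto simp: bij_betw_def image_iff)
  have "(\<Union>t \<in> pverts (star m). ?bag t) = pverts G"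
  proof
    show "(\<Union>t \<in> pverts (star m). ?bag t) \<subseteq> pverts G"
    proof (rule UN_least)
      fix t assume "t \<in> pverts (star m)"
      then show "?bag t \<subseteq> pverts G"
        using P q_out[of t] by (auto simp: star_def)
    qed
    show "pverts G \<subseteq> (\<Union>t \<in> pverts (star m). ?bag t)"
    proof
      fix v assume "v \<in> pverts G"
      then consider "v \<in> P" | i where "i \<in> {1..m}" "v = q i" using q_surj by blast
      then show "v \<in> (\<Union>t \<in> pverts (star m). ?bag t)"
      proof cases
        case 1
        then have "v \<in> ?bag 0" by simp
        then show ?thesis by (fastforce simp: star_def)
      next
        case 2
        then show ?thesis by (force simp: star_def)
      qed
    qed
  qed
  moreover have "\<exists>t \<in> pverts (star m). u \<in> ?bag t \<and> v \<in> ?bag t" if uv: "(u, v) \<in> parcs G" for u v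
  proof -
    have V: "u \<in> pverts G" "v \<in> pverts G" using uv in_arcsD1 in_arcsD2 by auto
    consider "u \<in> P" "v \<in> P" | i where "i \<in> {1..m}" "v = q i" "u \<in> P"
      | i where "i \<in> {1..m}" "u = q i" "v \<in> P"
    proof (cases "u \<in> P"; cases "v \<in> P")
      assume "u \<notin> P" "v \<notin> P"
      then show ?thesis using V indep uv by auto
    qed (use V q_surj that in metis)+
    then show ?thesis
    proof cases
      case 1
      then show ?thesis by (intro bexI[of _ 0]) (auto simp: star_def)
    next
      case (2 i)
      then show ?thesis using uv by (intro bexI[of _ i]) (auto simp: star_def)
    next
      case (3 i)
      then show ?thesis using symG[OF uv] by (intro bexI[of _ i]) (auto simp: star_def)
    qed
  qed
  moreover have "connected (with_proj (star m) \<restriction> {t \<in> pverts (star m). v \<in> ?bag t})"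
    if v: "v \<in> pverts G" for v
  proof (cases "v \<in> P")
    case True
    define S where "S = {t \<in> pverts (star m). v \<in> ?bag t}"
    let ?E = "parcs (star m) \<inter> S \<times> S"
    have S0: "0 \<in> S" using True by (simp add: S_def star_def)
    have "(x, 0) \<in> ?E\<^sup>* \<and> (0, x) \<in> ?E\<^sup>*" if "x \<in> S" for x
    proof (cases "x = 0")
      case False
      then have "(x, 0) \<in> ?E" "(0, x) \<in> ?E"
        using that S0 by (auto simp: star_def S_def)
      then show ?thesis by (meson r_into_rtrancl)
    qed simp
    then have "\<forall>x\<in>S. \<forall>y\<in>S. (x, y) \<in> ?E\<^sup>*"
      by (meson rtrancl_trans)
    then show ?thesis
      using S0 unfolding connected_induce_iff[OF symS] S_def[symmetric] by blast
  next
    case False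
    then obtain i where i: "i \<in> {1..m}" "v = q i" using v q_surj by blast
    have "{t \<in> pverts (star m). v \<in> ?bag t} = {i}"
    proof (intro equalityI subsetI)
      fix t assume t: "t \<in> {t \<in> pverts (star m). v \<in> ?bag t}"
      then have "t \<in> {1..m}" "q t = q i"
        using False i(2) by (auto simp: star_def split: if_splits)
      then show "t \<in> {i}"
        using inj_onD[OF bij_betw_imp_inj_on[OF q], of t i] i(1) by simp
    qed (use i in \<open>auto simp: star_def\<close>)
    then show ?thesis
      unfolding connected_induce_iff[OF symS] by simp
  qed
  ultimately show ?thesis
    using undirected_tree_star unfolding tree_decomposition_def by blast
qed

subsection \<open>Bipartite Kneser graphs\<close>

lemma pverts_bipartite_kneser:
  "pverts (bipartite_kneser n k) =
    {A. A \<subseteq> {1..n} \<and> card A = k} \<union> {B. B \<subseteq> {1..n} \<and> card B = n - k}"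
  by (simp add: bipartite_kneser_def Let_def)

lemma arc_bipartite_kneser_iff:
  "(A, B) \<in> parcs (bipartite_kneser n k) \<longleftrightarrow> A \<subseteq> {1..n} \<and> B \<subseteq> {1..n} \<and>
    (card A = k \<and> card B = n - k \<and> A \<subseteq> B \<or> card A = n - k \<and> card B = k \<and> B \<subseteq> A)"
  by (auto simp: bipartite_kneser_def Let_def)

lemma bipartite_kneser_no_balanced_separation:
  assumes n: "2 * k + 1 \<le> n" and k: "2 \<le> k"
    and ratio: "2 * (n choose k) \<le> 3 * ((n - k) choose k)"
    and V: "pverts (bipartite_kneser n k) = X \<union> A \<union> B"
      "X \<inter> A = {}" "X \<inter> B = {}" "A \<inter> B = {}"
    and sep: "parcs (bipartite_kneser n k) \<inter> A \<times> B = {}"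
    and cX: "card X < n choose k"
  shows "3 * card A \<le> n choose k \<or> 3 * card B \<le> n choose k"
proof (rule ccontr)
  assume big: "\<not> ?thesis"
  interpret K: kneser_ratio "{1..n}" n k
    using n k ratio by unfold_locales auto
  let ?N = "n choose k"
  define P where "P = {A. A \<subseteq> {1..n} \<and> card A = k}"
  define Q where "Q = {A. A \<subseteq> {1..n} \<and> card A = n - k}"
  have finP: "finite P" and finQ: "finite Q" by (auto simp: P_def Q_def)
  have cP: "card P = ?N" by (simp add: P_def n_subsets)
  have cQ: "card Q = ?N"
    using n binomial_symmetric[of k n] by (simp add: Q_def n_subsets)
  have PQ: "P \<inter> Q = {}" using n by (auto simp: P_def Q_def)
  have V': "P \<union> Q = X \<union> A \<union> B"
    using V(1) by (simp add: pverts_bipartite_kneser P_def Q_def)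
  have split: "card R = card (R \<inter> X) + card (R \<inter> A) + card (R \<inter> B)" if "R \<subseteq> P \<union> Q" for R
  proof -
    have fin: "finite R" using that finP finQ finite_subset by blast
    have "R = (R \<inter> X \<union> R \<inter> A) \<union> R \<inter> B" using that V' by blast
    also have "card \<dots> = card (R \<inter> X) + card (R \<inter> A) + card (R \<inter> B)"
      using fin V(2-4) by (subst card_Un_disjoint card_Un_disjoint[of "R \<inter> X"]; auto)+
    finally show ?thesis .
  qed
  have fin: "finite X" "finite A" "finite B"
    using V' finP finQ by (metis finite_Un)+
  have parts: "card S = card (P \<inter> S) + card (Q \<inter> S)" if "S \<subseteq> P \<union> Q" for S
  proof -
    have "S = (P \<inter> S) \<union> (Q \<inter> S)" using that by blast
    then show ?thesis
      using PQ finP finQ card_Un_disjoint[of "P \<inter> S" "Q \<inter> S"] by auto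
  qed
  \<comment> \<open>For an (n - k)-set b, the complement is a k-set, and a \<subseteq> b fails
    exactly when a meets that complement.\<close>
  have cross: "3 * card (P \<inter> S) \<le> ?N \<and> 3 * card (Q \<inter> R) \<le> ?N \<and>
      2 * (card (P \<inter> S) + card (Q \<inter> R)) \<le> ?N"
    if ne: "card (P \<inter> S) \<noteq> 0" "card (Q \<inter> R) \<noteq> 0"
      and no: "\<And>a b. a \<in> P \<inter> S \<Longrightarrow> b \<in> Q \<inter> R \<Longrightarrow> \<not> a \<subseteq> b" for S R
  proof -
    let ?c = "\<lambda>b. {1..n} - b"
    have inj: "inj_on ?c (Q \<inter> R)"
      by (rule inj_onI) (auto simp: Q_def)
    have c: "card (?c ` (Q \<inter> R)) = card (Q \<inter> R)"
      using inj by (rule card_image)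
    have 1: "P \<inter> S \<subseteq> K.ksets" unfolding P_def K.ksets_def by blast
    have 2: "?c ` (Q \<inter> R) \<subseteq> K.ksets"
      unfolding K.ksets_def
    proof (rule image_subsetI)
      fix b assume "b \<in> Q \<inter> R"
      then have "b \<subseteq> {1..n}" "card b = n - k" by (auto simp: Q_def)
      then show "?c b \<in> {a. a \<subseteq> {1..n} \<and> card a = k}"
        using n by (simp add: card_Diff_subset finite_subset[of b "{1..n}"])
    qed
    have 3: "P \<inter> S \<noteq> {}" "?c ` (Q \<inter> R) \<noteq> {}" using ne by auto
    have 4: "a \<inter> b \<noteq> {}" if ab: "a \<in> P \<inter> S" "b \<in> ?c ` (Q \<inter> R)" for a b
    proof -
      obtain b' where "b = ?c b'" "b' \<in> Q \<inter> R" using ab(2) by blast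
      moreover have "a \<subseteq> {1..n}" using ab(1) unfolding P_def by blast
      ultimately show ?thesis using no[OF ab(1), of b'] by blast
    qed
    show ?thesis
      using K.cross_intersecting_card_add[OF 1 3(1) 2 3(2) 4] c by simp
  qed
  have AB: "\<not> a \<subseteq> b" if "a \<in> P \<inter> A" "b \<in> Q \<inter> B" for a b
  proof -
    have "(a, b) \<notin> parcs (bipartite_kneser n k)" using sep that by blast
    then show ?thesis using that by (simp add: P_def Q_def arc_bipartite_kneser_iff)
  qed
  have BA: "\<not> a \<subseteq> b" if "a \<in> P \<inter> B" "b \<in> Q \<inter> A" for a b
  proof -
    have "(b, a) \<notin> parcs (bipartite_kneser n k)" using sep that by blast
    then show ?thesis using that by (simp add: P_def Q_def arc_bipartite_kneser_iff)
  qed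
  \<comment> \<open>Inputs for a linear case split. If each of the two pairs has an empty member,
    then \<open>A\<close> or \<open>B\<close> is empty or a whole part lies in \<open>X\<close>,
    which is too small. If only one pair does, \<open>A\<close> or \<open>B\<close> equals a member
    of the other pair and has at most \<open>?N\<close> / 3 elements.\<close>
  have "card (P \<inter> X) \<le> card X" "card (Q \<inter> X) \<le> card X"
    using fin by (auto intro: card_mono)
  moreover have "card A = card (P \<inter> A) + card (Q \<inter> A)" "card B = card (P \<inter> B) + card (Q \<inter> B)"
    "card X = card (P \<inter> X) + card (Q \<inter> X)"
    by (rule parts, use V' in blast)+
  moreover have "?N = card (P \<inter> X) + card (P \<inter> A) + card (P \<inter> B)"
    "?N = card (Q \<inter> X) + card (Q \<inter> A) + card (Q \<inter> B)"
    using split[of P] split[of Q] cP cQ by auto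
  moreover have "card (P \<inter> A) = 0 \<or> card (Q \<inter> B) = 0 \<or>
      3 * card (P \<inter> A) \<le> ?N \<and> 3 * card (Q \<inter> B) \<le> ?N \<and>
      2 * (card (P \<inter> A) + card (Q \<inter> B)) \<le> ?N"
    using cross[of A B] AB by blast
  moreover have "card (P \<inter> B) = 0 \<or> card (Q \<inter> A) = 0 \<or>
      3 * card (P \<inter> B) \<le> ?N \<and> 3 * card (Q \<inter> A) \<le> ?N \<and>
      2 * (card (P \<inter> B) + card (Q \<inter> A)) \<le> ?N"
    using cross[of B A] BA by blast
  moreover have "?N < 3 * card A" "?N < 3 * card B" using big by auto
  moreover have "?N < card A + card B"
    using calculation(3-7) cX by linarith
  then have "2 * ?N < 2 * (card (P \<inter> A) + card (Q \<inter> B)) + 2 * (card (P \<inter> B) + card (Q \<inter> A))"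
    using calculation(3,4) by simp
  ultimately show False
    using cX by (elim disjE conjE) linarith+
qed

theorem theorem1p3:
  fixes n k :: nat
  assumes "n > 0" and "k > 0"
    and "n \<ge> 2 * k + 1"
    and "3 * ((n - k) choose k) \<ge> 2 * (n choose k)"
    and "k \<ge> 2"
  shows "treewidth (bipartite_kneser n k) = (n choose k) - 1"
proof -
  let ?G = "bipartite_kneser n k" and ?N = "n choose k"
  have graph: "pair_graph ?G"
    using pair_graph_bipartite_kneser assms(3) by simp
  define P where "P = {A. A \<subseteq> {1..n} \<and> card A = k}"
  define Q where "Q = {A. A \<subseteq> {1..n} \<and> card A = n - k}"
  have finP: "finite P" and finQ: "finite Q" by (auto simp: P_def Q_def)
  have cP: "card P = ?N" by (simp add: P_def n_subsets)
  have cQ: "card Q = ?N"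
    using assms(3) binomial_symmetric[of k n] by (simp add: Q_def n_subsets)
  have PQ: "P \<inter> Q = {}" using assms(3) by (auto simp: P_def Q_def)
  have V: "pverts ?G = P \<union> Q" by (simp add: pverts_bipartite_kneser P_def Q_def)
  have upper: "\<exists>(T :: nat pair_pre_digraph) bag. tree_decomposition ?G T bag \<and>
      decomposition_width T bag = ?N - 1"
  proof -
    have VP: "pverts ?G - P = Q" using V PQ by blast
    obtain q where q: "bij_betw q {1..?N} Q"
      using finite_same_card_bij[of "{1..?N}" Q] finQ cQ by auto
    let ?bag = "\<lambda>i. if i = 0 then P else insert (q i) {p \<in> P. (p, q i) \<in> parcs ?G}"
    have "tree_decomposition ?G (star ?N) ?bag"
    proof (rule star_decomposition[OF graph])
      show "parcs ?G \<inter> (pverts ?G - P) \<times> (pverts ?G - P) = {}"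
        using assms(3) unfolding VP by (auto simp: Q_def arc_bipartite_kneser_iff)
    qed (use V VP q in auto)
    moreover have "decomposition_width (star ?N) ?bag = ?N - 1"
    proof -
      have "card (?bag i) \<le> ?N" if "i \<le> ?N" for i
      proof (cases "i = 0")
        case False
        then have "q i \<in> Q" using q that by (auto simp: bij_betw_def)
        then have "card (q i) < card {1..n}" "q i \<subseteq> {1..n}"
          using assms by (auto simp: Q_def)
        \<comment> \<open>A \<open>k\<close>-set through a point \<open>x\<close> outside
          \<open>q i\<close> is not adjacent to \<open>q i\<close>. So the neighbourhood is a proper
          subset of \<open>P\<close>, which leaves room for \<open>q i\<close> itself in a bag of
          size \<open>?N\<close>.\<close>
        then obtain x where x: "x \<in> {1..n}" "x \<notin> q i"
          by (metis less_irrefl subsetI subset_antisym)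
        have "k - 1 \<le> card ({1..n} - {x})"
          using x assms(3) by simp
        then obtain S where S: "S \<subseteq> {1..n} - {x}" "card S = k - 1"
          by (rule obtain_subset_with_card_n)
        have "finite S" using S(1) by (rule finite_subset) simp
        moreover have "x \<notin> S" "insert x S \<subseteq> {1..n}" using S(1) x(1) by blast+
        ultimately have xS: "insert x S \<in> P"
          using S(2) assms(2) by (simp add: P_def)
        have "(insert x S, q i) \<notin> parcs ?G"
        proof
          assume "(insert x S, q i) \<in> parcs ?G"
          moreover have "card (insert x S) = k" "card (q i) = n - k" "k \<noteq> n - k"
            using xS \<open>q i \<in> Q\<close> assms(3) by (auto simp: P_def Q_def)
          ultimately show False
            using x by (auto simp: arc_bipartite_kneser_iff)
        qed
        then have "{p \<in> P. (p, q i) \<in> parcs ?G} \<subset> P" using xS by blast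
        then have "card {p \<in> P. (p, q i) \<in> parcs ?G} < ?N"
          using psubset_card_mono[OF finP] cP by simp
        then show ?thesis
          using False finP card_insert_le_m1[of ?N "{p \<in> P. (p, q i) \<in> parcs ?G}" "q i"]
          by (simp add: card_insert_if)
      qed (simp add: cP)
      moreover have "?N \<in> (\<lambda>i. card (?bag i)) ` pverts (star ?N)"
        by (rule image_eqI[of _ _ 0]) (simp_all add: star_def cP)
      moreover have "finite (pverts (star ?N))" and "i \<le> ?N" if "i \<in> pverts (star ?N)" for i
        using that by (simp_all add: star_def)
      ultimately have "Max ((\<lambda>i. card (?bag i)) ` pverts (star ?N)) = ?N"
        by (intro Max_eqI finite_imageI) blast+
      then show ?thesis by (simp add: decomposition_width_def)
    qed
    ultimately show ?thesis by blast
  qed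
  have lower: "?N - 1 \<le> decomposition_width T bag" if dec: "tree_decomposition ?G T bag"
    for T :: "nat pair_pre_digraph" and bag
  proof -
    interpret tree_decomposed_graph ?G T bag
      using graph dec by (rule tree_decomposed_graph.intro)
    have "2 * ?N \<le> card (pverts ?G)"
      using V PQ finP finQ cP cQ by (simp add: card_Un_disjoint)
    \<comment> \<open>With m = \<open>?N\<close>, the size condition 2 m \<le> |V| of
      \<open>balanced_separation\<close> just holds, and the separation it would give if all bags
      were smaller has been excluded.\<close>
    then have "\<exists>t \<in> pverts T. ?N \<le> card (bag t)"
      using balanced_separation[of ?N] bipartite_kneser_no_balanced_separation[OF assms(3,5,4)]
      by (meson not_le)
    then obtain t where "t \<in> pverts T" "?N \<le> card (bag t)" by blast
    then have "?N \<le> Max ((\<lambda>t. card (bag t)) ` pverts T)"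
      by (meson Max_ge T.pair_finite_verts finite_imageI image_eqI order_trans)
    then show ?thesis by (simp add: decomposition_width_def)
  qed
  show ?thesis
    unfolding treewidth_def using upper lower by (intro Least_equality) auto
qed

end
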